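(* There exist constants $c>0$ and $n_0\in\mathbb{N}$ such that for all $n\ge n_0$ and all integers $k$ with $0.111n<k<0.5n$, \[\alpha_{n,k} \ge \binom{n}{k-1}\left(1 - \exp\!\left(-c\,\frac{n}{\log n}\right)\right).\]
   Context: $\mathcal{P}_{\mathrm{fin},0}(\mathbb{N}_0)$ is the monoid of finite subsets of $\mathbb{N}_0$ containing $0$ under sumset $A+B=\{a+b: a\in A, b\in B\}$, with identity $\{0\}$. An atom is an element $A\ne\{0\}$ such that $A=B+C$ with $B,C\in\mathcal{P}_{\mathrm{fin},0}(\mathbb{N}_0)$ implies $B=\{0\}$ or $C=\{0\}$; let $\mathcal{A}$ be the set of atoms. For $n,k\in\mathbb{N}$, $\mathcal{A}_{n,k}=\{A\in\mathcal{A} : \max A\le n,\ |A|=k\}$ and $\alpha_{n,k}=|\mathcal{A}_{n,k}|$. (The paper writes the bound as $\binom{n}{k-1}(1-\exp(-\Omega(n/\log n)))$.) *)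

theory Defs
  imports Complex_Main "HOL-Library.Set_Algebras"
begin

text \<open>The operation \<open>+\<close> on sets is the sumset of \<open>HOL-Library.Set_Algebras\<close>.\<close>

definition Pfin0 :: "nat set set" where
  "Pfin0 = {A. finite A \<and> 0 \<in> A}"

definition atoms :: "nat set set" where
  "atoms = {A \<in> Pfin0. A \<noteq> {0} \<and>
     (\<forall>B \<in> Pfin0. \<forall>C \<in> Pfin0. A = B + C \<longrightarrow> B = {0} \<or> C = {0})}"

definition atoms_nk :: "nat \<Rightarrow> nat \<Rightarrow> nat set set" where
  "atoms_nk n k = {A \<in> atoms. Max A \<le> n \<and> card A = k}"

definition alpha :: "nat \<Rightarrow> nat \<Rightarrow> nat" where
  "alpha n k = card (atoms_nk n k)"

end

theory Submission
  imports Defs "HOL-Library.Disjoint_Sets" "HOL-Real_Asymp.Real_Asymp"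
begin

text \<open>Let \<open>A = B + C\<close> with \<open>B, C \<noteq> {0}\<close>, where \<open>A\<close> is a uniformly random set of size \<open>k\<close>.
  If one summand has at most 31 elements, then \<open>A\<close> has no point isolated in its window
  \<open>x + (B - B)\<close>, which for each of the polynomially many \<open>B\<close> is exponentially unlikely.
  If both have at least 32 elements and one of them, say \<open>C\<close>, has more than \<open>n / 500\<close>, then \<open>A\<close>
  contains linearly many disjoint translates of a fixed 32-element set, which is again
  exponentially unlikely. If both have at most about \<open>n / 500\<close> elements, there are exponentially
  fewer pairs \<open>(B, C)\<close> than sets \<open>A\<close>. This yields even an error term \<open>exp (- c * n)\<close>.\<close>

section \<open>Counting small subsets by weights\<close>

lemma sum_power_card_Pow:
  fixes z :: "'b::comm_semiring_1"
  assumes "finite U"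
  shows "(\<Sum>A\<in>Pow U. z ^ card A) = (1 + z) ^ card U"
  using assms
proof (induction U rule: finite_induct)
  case (insert u U)
  have "inj_on (insert u) (Pow U)"
    using insert.hyps by (auto simp: inj_on_def)
  moreover have "Pow U \<inter> insert u ` Pow U = {}"
    using insert.hyps by auto
  moreover have "(\<Sum>A\<in>Pow U. z ^ card (insert u A)) = (\<Sum>A\<in>Pow U. z * z ^ card A)"
  proof (rule sum.cong)
    fix A assume "A \<in> Pow U"
    then have "finite A" "u \<notin> A"
      using insert.hyps finite_subset by auto
    then show "z ^ card (insert u A) = z * z ^ card A"
      by simp
  qed simp
  ultimately show ?case
    using insert by (simp add: Pow_insert sum.union_disjoint sum.reindex sum_distrib_left[symmetric]
        algebra_simps)
qed simp

text \<open>Rankin's trick: since \<open>y \<le> 1\<close>, every set counted has weight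
  \<open>y ^ card A\<close> at least \<open>y ^ m\<close>, and the weights of all subsets add up to
  the right-hand side.\<close>

lemma card_subsets_le_mult_power:
  fixes y :: real
  assumes "finite U" "0 < y" "y \<le> 1"
  shows "real (card {A. A \<subseteq> U \<and> card A \<le> m}) * y ^ m \<le> (1 + y) ^ card U"
proof -
  have "real (card {A. A \<subseteq> U \<and> card A \<le> m}) * y ^ m = (\<Sum>A\<in>{A. A \<subseteq> U \<and> card A \<le> m}. y ^ m)"
    by simp
  also have "\<dots> \<le> (\<Sum>A\<in>{A. A \<subseteq> U \<and> card A \<le> m}. y ^ card A)"
    using assms by (intro sum_mono power_decreasing) auto
  also have "\<dots> \<le> (\<Sum>A\<in>Pow U. y ^ card A)"
    using assms by (intro sum_mono2) auto
  finally show ?thesis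
    using assms by (simp add: sum_power_card_Pow)
qed

text \<open>The choice \<open>y = 1 / card U\<close> in the weighted bound keeps
  \<open>(1 + y) ^ card U\<close> below \<open>exp 1\<close>. This makes the number of summands of
  bounded size polynomial in \<open>n\<close>.\<close>

lemma card_subsets_le_polynomial:
  assumes "finite U" "U \<noteq> {}"
  shows "real (card {A. A \<subseteq> U \<and> card A \<le> m}) \<le> 3 * real (card U) ^ m"
proof -
  define u where "u = card U"
  have u: "real u > 0" "1 \<le> real u"
    using assms by (auto simp: u_def card_gt_0_iff Suc_le_eq)
  have "real (card {A. A \<subseteq> U \<and> card A \<le> m}) * (1 / real u) ^ m \<le> (1 + 1 / real u) ^ u"
    unfolding u_def using u assms
    by (intro card_subsets_le_mult_power) (auto simp: u_def[symmetric])
  also have "\<dots> \<le> exp (1 / real u) ^ u"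
    using u by (intro power_mono exp_ge_add_one_self) auto
  also have "\<dots> = exp 1"
    using u by (simp add: exp_of_nat_mult[symmetric])
  also have "\<dots> \<le> 3"
    by (rule exp_le)
  finally show ?thesis
    using u by (simp add: u_def[symmetric] power_divide field_simps)
qed

section \<open>From the binomial model to uniform \<open>j\<close>-subsets\<close>

text \<open>The step from term \<open>i\<close> to term \<open>i + 1\<close> multiplies by
  \<open>(n - i) * z / (i + 1)\<close>. For \<open>z = j / (n - j)\<close> this factor is at least 1
  when \<open>i < j\<close> and at most 1 when \<open>i \<ge> j\<close>, so the weights rise up to
  \<open>j\<close> and fall afterwards.\<close>

lemma binomial_weight_le_mode:
  fixes n j i :: nat
  assumes "j < n" "i \<le> n"
  defines "z \<equiv> real j / real (n - j)"
  shows "real (n choose i) * z ^ i \<le> real (n choose j) * z ^ j"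
proof -
  define T where "T i = real (n choose i) * z ^ i" for i
  have z: "z \<ge> 0" "z * (real n - real j) = real j"
    using assms by (auto simp: z_def of_nat_diff)
  have step: "real (Suc i) * T (Suc i) = real (n - i) * z * T i" for i
  proof -
    have "Suc i * (n choose Suc i) = (n - i) * (n choose i)"
      by (metis binomial_absorb_comp binomial_absorption)
    then have "real (Suc i) * real (n choose Suc i) = real (n - i) * real (n choose i)"
      by (metis of_nat_mult)
    then show ?thesis
      by (simp add: T_def algebra_simps)
  qed
  have Tnn: "T i \<ge> 0" for i
    using z by (simp add: T_def)
  \<comment> \<open>Multiplying by \<open>n - j\<close> clears the denominator of \<open>z\<close>,
    so comparing the step factor with 1 becomes a polynomial inequality.\<close>
  have key: "(real n - real j) * (real (n - i) * z) = (real n - real i) * real j" if "i \<le> n" for i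
  proof -
    have "(real n - real j) * (real (n - i) * z) = (real n - real i) * (z * (real n - real j))"
      using that by (simp add: of_nat_diff)
    then show ?thesis
      by (simp only: z(2))
  qed
  have up: "T i \<le> T (Suc i)" if "i < j" for i
  proof -
    have "(real n - real j) * real (Suc i) \<le> (real n - real j) * (real (n - i) * z)"
    proof -
      have "real n * (real i + 1) \<le> real n * real j"
        using that by (intro mult_left_mono) auto
      then show ?thesis
        using that assms(1) by (subst key) (simp_all add: algebra_simps)
    qed
    then have "real (Suc i) \<le> real (n - i) * z"
      using assms(1) by (simp del: of_nat_Suc of_nat_diff)
    then have "real (Suc i) * T i \<le> real (Suc i) * T (Suc i)"
      unfolding step by (intro mult_right_mono Tnn)
    then show ?thesis
      by (simp del: of_nat_Suc)
  qed
  have down: "T (Suc i) \<le> T i" if "j \<le> i" "i < n" for i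
  proof -
    have "(real n - real j) * (real (n - i) * z) \<le> (real n - real j) * real (Suc i)"
    proof -
      have "(real n - real j) * real (Suc i) - (real n - real i) * real j
          = (real n - real j) + real n * (real i - real j)"
        by (simp add: algebra_simps)
      moreover have "\<dots> \<ge> 0"
        using that assms(1) by simp
      ultimately show ?thesis
        using that by (simp only: key)
    qed
    then have "real (n - i) * z \<le> real (Suc i)"
      using assms(1) by (simp del: of_nat_Suc of_nat_diff)
    then have "real (Suc i) * T (Suc i) \<le> real (Suc i) * T i"
      unfolding step by (intro mult_right_mono Tnn)
    then show ?thesis
      by (simp del: of_nat_Suc)
  qed
  have "T i \<le> T j"
  proof (cases "i \<le> j")
    case True
    then show ?thesis
      by (induction i rule: inc_induct) (auto intro: up order_trans)
  next
    case False
    then have "j \<le> i" by simp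
    then show ?thesis
      using \<open>i \<le> n\<close>
    proof (induction i rule: dec_induct)
      case (step i)
      then show ?case
        using down[of i] by simp
    qed simp
  qed
  then show ?thesis
    by (simp add: T_def)
qed

lemma power_one_plus_le_mode:
  fixes n j :: nat
  assumes "j < n"
  defines "z \<equiv> real j / real (n - j)"
  shows "(1 + z) ^ n \<le> (real n + 1) * real (n choose j) * z ^ j"
proof -
  have "(1 + z) ^ n = (\<Sum>i\<le>n. real (n choose i) * z ^ i)"
    using binomial_ring[of z 1 n] by (simp add: add.commute)
  also have "\<dots> \<le> (\<Sum>i\<le>n. real (n choose j) * z ^ j)"
    unfolding z_def using assms(1) by (intro sum_mono binomial_weight_le_mode) auto
  finally show ?thesis
    by (simp add: algebra_simps)
qed

text \<open>Passing from the binomial model with odds \<open>z = j / (n - j)\<close> to the uniform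
  \<open>j\<close>-subset costs only a factor \<open>n + 1\<close>.\<close>

lemma card_uniform_le_binomial:
  fixes n j :: nat and F :: "'a set set" and t :: real
  assumes j: "0 < j" "j < n" and F: "finite F"
  defines "z \<equiv> real j / real (n - j)"
  assumes t: "(\<Sum>A\<in>F. z ^ card A) \<le> (1 + z) ^ n * t" "t \<ge> 0"
  shows "real (card {A\<in>F. card A = j}) \<le> (real n + 1) * real (n choose j) * t"
proof -
  have z: "z > 0"
    using j by (simp add: z_def)
  \<comment> \<open>All sets counted have the same weight \<open>z ^ j\<close>, which cancels
    against the modal term bounding \<open>(1 + z) ^ n\<close>.\<close>
  have "real (card {A\<in>F. card A = j}) * z ^ j = (\<Sum>A\<in>{A\<in>F. card A = j}. z ^ card A)"
    by simp
  also have "\<dots> \<le> (\<Sum>A\<in>F. z ^ card A)"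
    using F z by (intro sum_mono2) auto
  also have "\<dots> \<le> (1 + z) ^ n * t"
    by (rule t)
  also have "\<dots> \<le> ((real n + 1) * real (n choose j) * z ^ j) * t"
    unfolding z_def using t by (intro mult_right_mono power_one_plus_le_mode j)
  finally show ?thesis
    using z by (simp add: mult.assoc mult.left_commute[of _ "z ^ j"] mult.commute[of _ "z ^ j"])
qed

section \<open>Independence and exponentially unlikely events\<close>

text \<open>Independence in the binomial model: a set splits uniquely into its traces on
  \<open>U\<close> and \<open>V\<close>, and its weight is the product of their weights.\<close>

lemma sum_power_card_product:
  fixes z :: "'b::comm_semiring_1"
  assumes "finite U" "finite V" "U \<inter> V = {}" "F \<subseteq> Pow U" "G \<subseteq> Pow V"
  shows "(\<Sum>A\<in>{A. A \<subseteq> U \<union> V \<and> A \<inter> U \<in> F \<and> A \<inter> V \<in> G}. z ^ card A)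
    = (\<Sum>A\<in>F. z ^ card A) * (\<Sum>A\<in>G. z ^ card A)"
proof -
  have "(\<Sum>A\<in>F. z ^ card A) * (\<Sum>A\<in>G. z ^ card A)
      = (\<Sum>(A, B)\<in>F \<times> G. z ^ card A * z ^ card B)"
    by (simp add: sum_product sum.cartesian_product)
  also have "\<dots> = (\<Sum>A\<in>{A. A \<subseteq> U \<union> V \<and> A \<inter> U \<in> F \<and> A \<inter> V \<in> G}. z ^ card A)"
  proof (rule sum.reindex_bij_witness[where i = "\<lambda>A. (A \<inter> U, A \<inter> V)" and j = "\<lambda>(A, B). A \<union> B"], goal_cases)
    case (1 a)
    then show ?case
      using assms by (cases a) fastforce
  next
    case (2 a)
    obtain A B where a: "a = (A, B)" by (cases a)
    have "A \<subseteq> U" "B \<subseteq> V" "A \<in> F" "B \<in> G"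
      using 2 assms a by auto
    moreover have "(A \<union> B) \<inter> U = A" "(A \<union> B) \<inter> V = B"
      using \<open>A \<subseteq> U\<close> \<open>B \<subseteq> V\<close> assms by auto
    ultimately show ?case
      using a by auto
  next
    case (3 A)
    then show ?case by auto
  next
    case (4 A)
    then show ?case by auto
  next
    case (5 a)
    obtain A B where a: "a = (A, B)" by (cases a)
    have "A \<subseteq> U" "B \<subseteq> V"
      using 5 assms a by auto
    then have "card (A \<union> B) = card A + card B"
      using assms by (intro card_Un_disjoint) (auto intro: finite_subset)
    then show ?case
      using a by (simp add: power_add)
  qed
  finally show ?thesis by simp
qed

text \<open>After division by \<open>(1 + z) ^ card U\<close> the weights describe a random set that
  contains each point independently with probability \<open>z / (1 + z)\<close>, at most 1/2 because
  \<open>z \<le> 1\<close>.\<close>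

lemma sum_power_card_supersets:
  fixes z :: real
  assumes "finite U" "Y \<subseteq> U" "0 \<le> z" "z \<le> 1"
  shows "(\<Sum>A\<in>{A. A \<subseteq> U \<and> Y \<subseteq> A}. z ^ card A) \<le> (1 + z) ^ card U * (1 / 2) ^ card Y"
proof -
  have fin: "finite Y" "finite (U - Y)"
    using assms finite_subset by auto
  have "{A. A \<subseteq> U \<and> Y \<subseteq> A} = {A. A \<subseteq> Y \<union> (U - Y) \<and> A \<inter> Y \<in> {Y} \<and> A \<inter> (U - Y) \<in> Pow (U - Y)}"
    using assms by auto
  then have "(\<Sum>A\<in>{A. A \<subseteq> U \<and> Y \<subseteq> A}. z ^ card A) = z ^ card Y * (1 + z) ^ card (U - Y)"
    using fin sum_power_card_product[of Y "U - Y" "{Y}" "Pow (U - Y)" z]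
    by (simp add: sum_power_card_Pow)
  also have "\<dots> \<le> ((1 + z) * (1 / 2)) ^ card Y * (1 + z) ^ card (U - Y)"
    using assms by (intro mult_right_mono power_mono) auto
  also have "\<dots> = (1 + z) ^ (card Y + card (U - Y)) * (1 / 2) ^ card Y"
    by (simp add: power_mult_distrib power_add power_divide)
  also have "card Y + card (U - Y) = card U"
    using assms fin by (simp add: card_Diff_subset card_mono)
  finally show ?thesis .
qed

text \<open>Disjoint windows make the events \<open>A \<inter> W x = {x}\<close> independent. Each
  has probability \<open>z / (1 + z) ^ card (W x)\<close>, hence at least \<open>p\<close>. The
  induction splits off one window at a time.\<close>

lemma sum_power_card_no_isolated:
  fixes z p :: real and W :: "'a \<Rightarrow> 'a set"
  assumes z: "0 \<le> z" and p: "0 \<le> p" "p \<le> 1" "p * (1 + z) ^ w \<le> z"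
    and X: "finite X"
    and U: "finite U" "\<And>x. x \<in> X \<Longrightarrow> W x \<subseteq> U"
    and W: "\<And>x. x \<in> X \<Longrightarrow> x \<in> W x" "\<And>x. x \<in> X \<Longrightarrow> card (W x) \<le> w" "disjoint_family_on W X"
  shows "(\<Sum>A\<in>{A. A \<subseteq> U \<and> (\<forall>x\<in>X. A \<inter> W x \<noteq> {x})}. z ^ card A) \<le> (1 + z) ^ card U * (1 - p) ^ card X"
  using X U W
proof (induction X arbitrary: U rule: finite_induct)
  case empty
  then show ?case
    using sum_power_card_Pow[of U z] by (simp add: Pow_def)
next
  case (insert x X)
  define V where "V = U - W x"
  define F where "F = Pow (W x) - {{x}}"
  define G where "G = {A. A \<subseteq> V \<and> (\<forall>y\<in>X. A \<inter> W y \<noteq> {y})}"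
  have Wx: "W x \<subseteq> U" "finite (W x)" "x \<in> W x" "card (W x) \<le> w"
    using insert.prems finite_subset[of "W x" U] by auto
  have disj: "W y \<inter> W x = {}" if "y \<in> X" for y
    using insert.prems(5) insert.hyps that by (auto simp: disjoint_family_on_def)
  have sub: "W y \<subseteq> V" if "y \<in> X" for y
    using disj[OF that] insert.prems(2)[of y] that by (auto simp: V_def)
  have eq: "{A. A \<subseteq> U \<and> (\<forall>y\<in>insert x X. A \<inter> W y \<noteq> {y})}
      = {A. A \<subseteq> W x \<union> V \<and> A \<inter> W x \<in> F \<and> A \<inter> V \<in> G}"
  proof -
    have "A \<inter> V \<inter> W y = A \<inter> W y" if "y \<in> X" for A y
      using sub[OF that] by auto
    then show ?thesis
      using Wx(1) by (auto simp: F_def G_def V_def)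
  qed
  have "(\<Sum>A\<in>{A. A \<subseteq> U \<and> (\<forall>y\<in>insert x X. A \<inter> W y \<noteq> {y})}. z ^ card A)
      = (\<Sum>A\<in>F. z ^ card A) * (\<Sum>A\<in>G. z ^ card A)"
    unfolding eq using Wx insert.prems(1)
    by (intro sum_power_card_product) (auto simp: V_def F_def G_def)
  also have "\<dots> \<le> ((1 + z) ^ card (W x) * (1 - p)) * ((1 + z) ^ card V * (1 - p) ^ card X)"
  proof (intro mult_mono)
    have "(\<Sum>A\<in>F. z ^ card A) = (1 + z) ^ card (W x) - z"
      using Wx unfolding F_def by (subst sum_diff1) (auto simp: sum_power_card_Pow)
    moreover have "p * (1 + z) ^ card (W x) \<le> p * (1 + z) ^ w"
      using p z Wx by (intro mult_left_mono power_increasing) auto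
    ultimately show "(\<Sum>A\<in>F. z ^ card A) \<le> (1 + z) ^ card (W x) * (1 - p)"
      using p by (simp add: algebra_simps)
    show "(\<Sum>A\<in>G. z ^ card A) \<le> (1 + z) ^ card V * (1 - p) ^ card X"
      unfolding G_def using insert.prems sub
      by (intro insert.IH) (auto simp: V_def disjoint_family_on_def)
  qed (use z p in \<open>auto intro: sum_nonneg\<close>)
  also have "\<dots> = (1 + z) ^ (card (W x) + card V) * (1 - p) ^ card (insert x X)"
    using insert.hyps by (simp add: power_add)
  also have "card (W x) + card V = card U"
    using Wx insert.prems(1) by (simp add: V_def card_Diff_subset card_mono)
  finally show ?case .
qed

text \<open>Greedy selection: choose any \<open>x\<close>, discard the at most \<open>d\<close>
  indices \<open>y\<close> whose sets meet \<open>V x\<close>, and repeat. Since \<open>V x\<close>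
  is nonempty, \<open>x\<close> itself is among the discarded indices.\<close>

lemma greedy_disjoint_subfamily:
  fixes V :: "'a \<Rightarrow> 'b set"
  assumes "finite S" "\<And>x. x \<in> S \<Longrightarrow> V x \<noteq> {}"
    and "\<And>x. x \<in> S \<Longrightarrow> card {y\<in>S. V x \<inter> V y \<noteq> {}} \<le> d"
  shows "\<exists>X\<subseteq>S. disjoint_family_on V X \<and> card S \<le> d * card X"
  using assms
proof (induction S rule: finite_psubset_induct)
  case (psubset S)
  show ?case
  proof (cases "S = {}")
    case True
    then show ?thesis by (auto simp: disjoint_family_on_def)
  next
    case False
    then obtain x where x: "x \<in> S" by auto
    define N where "N = {y\<in>S. V x \<inter> V y \<noteq> {}}"
    have xN: "x \<in> N" "N \<subseteq> S"
      using x psubset.prems(1) by (auto simp: N_def)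
    have "\<exists>X\<subseteq>S - N. disjoint_family_on V X \<and> card (S - N) \<le> d * card X"
    proof (rule psubset.IH)
      show "S - N \<subset> S"
        using xN x by auto
      fix y assume y: "y \<in> S - N"
      then show "V y \<noteq> {}"
        using psubset.prems by auto
      have "card {u\<in>S - N. V y \<inter> V u \<noteq> {}} \<le> card {u\<in>S. V y \<inter> V u \<noteq> {}}"
        using psubset.hyps by (intro card_mono) auto
      then show "card {u\<in>S - N. V y \<inter> V u \<noteq> {}} \<le> d"
        using psubset.prems(2)[of y] y by auto
    qed
    then obtain X where X: "X \<subseteq> S - N" "disjoint_family_on V X" "card (S - N) \<le> d * card X"
      by blast
    have "finite X" "x \<notin> X"
      using X(1) psubset.hyps finite_subset[of X S] xN by auto
    have "card S = card N + card (S - N)"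
      using xN psubset.hyps by (simp add: card_Diff_subset card_mono finite_subset)
    also have "\<dots> \<le> d + d * card X"
      using psubset.prems(2)[OF x] X(3) by (simp add: N_def)
    also have "\<dots> = d * card (insert x X)"
      using \<open>finite X\<close> \<open>x \<notin> X\<close> by simp
    finally have "card S \<le> d * card (insert x X)" .
    moreover have "disjoint_family_on V (insert x X)"
      using X(1,2) by (auto simp: disjoint_family_on_def N_def)
    ultimately show ?thesis
      using X(1) x by (intro exI[of _ "insert x X"]) auto
  qed
qed

lemma card_subsets_containing_le:
  fixes n j :: nat
  assumes "0 < j" "j < n" "real j / real (n - j) \<le> 1" "Y \<subseteq> {1..n}"
  shows "real (card {A. A \<subseteq> {1..n} \<and> card A = j \<and> Y \<subseteq> A})
    \<le> (real n + 1) * real (n choose j) * (1 / 2) ^ card Y"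
proof -
  have "(\<Sum>A\<in>{A. A \<subseteq> {1..n} \<and> Y \<subseteq> A}. (real j / real (n - j)) ^ card A)
      \<le> (1 + real j / real (n - j)) ^ n * (1 / 2) ^ card Y"
    using sum_power_card_supersets[of "{1..n}" Y "real j / real (n - j)"] assms by simp
  from card_uniform_le_binomial[OF assms(1,2) _ this] show ?thesis
    by (simp add: conj_ac)
qed

section \<open>Sumsets with a summand of bounded size\<close>

text \<open>If \<open>x = b + c\<close> lies in \<open>B + C\<close>, then so does \<open>b' + c\<close> for another \<open>b' \<in> B\<close>; thus \<open>x\<close> is not
  isolated in the window \<open>x + (B - B)\<close>. A random set has an isolated point in one of linearly many
  disjoint windows.\<close>

lemma card_sumsets_fixed_summand:
  fixes n j q M :: nat and B :: "nat set" and p :: real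
  assumes j: "0 < j" "j < n" and z: "1 / 10 \<le> real j / real (n - j)" "real j / real (n - j) \<le> 1"
    and B: "2 \<le> card B" "card B \<le> q"
    and p: "0 \<le> p" "p \<le> 1" "p * 2 ^ (q ^ 2) \<le> 1 / 10"
    and M: "q ^ 4 * M + q ^ 2 \<le> n"
  shows "real (card {A. A \<subseteq> {1..n} \<and> card A = j \<and> (\<exists>C. insert 0 A = B + C)})
    \<le> (real n + 1) * real (n choose j) * (1 - p) ^ M"
proof -
  define z where "z = real j / real (n - j)"
  have finB: "finite B"
    using B by (metis card.infinite not_numeral_le_zero)
  \<comment> \<open>The window \<open>x + (B - B)\<close> cut down to \<open>{1..n}\<close>; stating
    membership additively avoids truncated subtraction.\<close>
  define W where "W x = {y\<in>{1..n}. \<exists>b\<in>B. \<exists>b'\<in>B. y + b = x + b'}" for x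
  \<comment> \<open>The nonnegative differences of \<open>B\<close>. For \<open>x\<close> outside
    \<open>R\<close> the replacement \<open>b' + c\<close> of \<open>x = b + c\<close> is never 0,
    so it lies in \<open>A\<close> and not merely in \<open>insert 0 A\<close>.\<close>
  define R where "R = {x. \<exists>b\<in>B. \<exists>b'\<in>B. b = x + b'}"
  have BB: "card (B \<times> B) \<le> q\<^sup>2" "finite (B \<times> B)"
    using B finB by (auto simp: card_cartesian_product power2_eq_square mult_mono)
  have "W x \<subseteq> (\<lambda>(b, b'). x + b' - b) ` (B \<times> B)" for x
    by (force simp: W_def)
  then have cardW: "card (W x) \<le> q\<^sup>2" for x
    using BB by (meson surj_card_le order_trans)
  have "R \<subseteq> (\<lambda>(b, b'). b - b') ` (B \<times> B)"
    by (force simp: R_def)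
  then have R: "card R \<le> q\<^sup>2" "finite R"
    using BB by (meson surj_card_le order_trans, meson BB(2) finite_imageI finite_subset)
  define S where "S = {1..n} - R"
  have xW: "x \<in> W x" if "x \<in> S" for x
  proof -
    obtain b where "b \<in> B"
      using B by fastforce
    then show ?thesis
      using that by (auto simp: W_def S_def)
  qed
  have "\<exists>X\<subseteq>S. disjoint_family_on W X \<and> card S \<le> q ^ 4 * card X"
  proof (rule greedy_disjoint_subfamily)
    fix x assume x: "x \<in> S"
    show "W x \<noteq> {}"
      using xW[OF x] by auto
    have finW: "finite (W y)" for y
      by (simp add: W_def)
    \<comment> \<open>A common point \<open>u\<close> of the two windows gives
      \<open>y \<in> W u\<close>, because \<open>B - B\<close> is symmetric. So \<open>y\<close>
      lies in one of at most \<open>q\<^sup>2\<close> windows of size at most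
      \<open>q\<^sup>2\<close>, which explains the degree \<open>q ^ 4\<close>.\<close>
    have "{y\<in>S. W x \<inter> W y \<noteq> {}} \<subseteq> (\<Union>u\<in>W x. W u)"
    proof
      fix y assume "y \<in> {y\<in>S. W x \<inter> W y \<noteq> {}}"
      then obtain u where "y \<in> S" "u \<in> W x" "u \<in> W y" by auto
      then have "y \<in> W u"
        by (auto simp: W_def S_def) metis
      then show "y \<in> (\<Union>u\<in>W x. W u)"
        using \<open>u \<in> W x\<close> by auto
    qed
    then have "card {y\<in>S. W x \<inter> W y \<noteq> {}} \<le> card (\<Union>u\<in>W x. W u)"
      using finW by (intro card_mono) auto
    also have "\<dots> \<le> (\<Sum>u\<in>W x. card (W u))"
      using finW by (intro card_UN_le)
    also have "\<dots> \<le> (\<Sum>u\<in>W x. q\<^sup>2)"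
      by (intro sum_mono cardW)
    also have "\<dots> \<le> q\<^sup>2 * q\<^sup>2"
      using cardW[of x] by (simp only: sum_constant mult_le_mono1 of_nat_id)
    finally show "card {y\<in>S. W x \<inter> W y \<noteq> {}} \<le> q ^ 4"
      by (simp flip: power_add)
  qed (simp add: S_def)
  then obtain X where X: "X \<subseteq> S" "disjoint_family_on W X" "card S \<le> q ^ 4 * card X"
    by blast
  have finX: "finite X"
    using X(1) by (rule finite_subset) (simp add: S_def)
  have "q ^ 4 * M \<le> n - card R"
    using M R by simp
  also have "\<dots> \<le> card S"
    using R diff_card_le_card_Diff[of R "{1..n}"] by (simp add: S_def)
  also note X(3)
  finally have MX: "M \<le> card X"
    using B by simp
  define F where "F = {A. A \<subseteq> {1..n} \<and> (\<forall>x\<in>X. A \<inter> W x \<noteq> {x})}"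
  have finF: "finite F"
    by (rule finite_subset[of _ "Pow {1..n}"]) (auto simp: F_def)
  have "(\<Sum>A\<in>F. z ^ card A) \<le> (1 + z) ^ card {1..n} * (1 - p) ^ card X"
    unfolding F_def
  proof (rule sum_power_card_no_isolated[where w = "q\<^sup>2"])
    \<comment> \<open>As \<open>z\<close> lies between 1/10 and 1, the assumption on
      \<open>p\<close> gives a lower bound on the isolation probability that is uniform in
      \<open>j\<close>.\<close>
    have "p * (1 + z) ^ (q\<^sup>2) \<le> p * 2 ^ (q\<^sup>2)"
      using p z by (intro mult_left_mono power_mono) (auto simp: z_def)
    also note p(3)
    also note z(1)
    finally show "p * (1 + z) ^ (q\<^sup>2) \<le> z"
      by (simp only: z_def)
    show "W x \<subseteq> {1..n}" for x
      by (auto simp: W_def)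
  qed (use X xW cardW finX p in \<open>auto simp: z_def\<close>)
  also have "\<dots> \<le> (1 + z) ^ n * (1 - p) ^ M"
    using MX p by (auto intro!: mult_left_mono power_decreasing simp: z_def)
  finally have sumF: "(\<Sum>A\<in>F. z ^ card A) \<le> (1 + z) ^ n * (1 - p) ^ M" .
  have "{A. A \<subseteq> {1..n} \<and> card A = j \<and> (\<exists>C. insert 0 A = B + C)} \<subseteq> {A\<in>F. card A = j}"
  proof -
    have "A \<inter> W x \<noteq> {x}" if A: "A \<subseteq> {1..n}" "insert 0 A = B + C" and x: "x \<in> X" for A C x
    proof
      assume *: "A \<inter> W x = {x}"
      then have "x \<in> B + C"
        using A by auto
      then obtain b c where bc: "b \<in> B" "c \<in> C" "x = b + c"
        by (auto elim: set_plus_elim)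
      have "B \<noteq> {b}"
        using B by auto
      then obtain b' where b': "b' \<in> B" "b' \<noteq> b"
        using bc by auto
      have mem: "b' + c \<in> insert 0 A"
        unfolding A(2) using b' bc by (intro set_plus_intro)
      have "x \<notin> R"
        using x X by (auto simp: S_def)
      then have "b' + c \<noteq> 0"
        using bc b' by (auto simp: R_def)
      then have "b' + c \<in> A"
        using mem by auto
      moreover have "b' + c + b = x + b'"
        using bc by simp
      then have "b' + c \<in> W x"
        using \<open>b' + c \<in> A\<close> A(1) bc(1) b'(1) unfolding W_def by blast
      ultimately have "b' + c = x"
        using * by blast
      then show False
        using bc b' by simp
    qed
    then show ?thesis
      by (auto simp: F_def)
  qed
  then have "card {A. A \<subseteq> {1..n} \<and> card A = j \<and> (\<exists>C. insert 0 A = B + C)} \<le> card {A\<in>F. card A = j}"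
    using finF by (intro card_mono) auto
  also have "real \<dots> \<le> (real n + 1) * real (n choose j) * (1 - p) ^ M"
    using card_uniform_le_binomial[OF j finF] sumF p unfolding z_def by simp
  finally show ?thesis by simp
qed

text \<open>A union bound over the polynomially many summands \<open>B\<close> with at most
  \<open>q\<close> elements. The constants depend only on \<open>q\<close>; \<open>d\<close> absorbs
  the rounding in the number of windows.\<close>

lemma card_sumsets_bounded_summand:
  fixes q :: nat
  assumes "q > 0"
  shows "\<exists>c d :: real. c > 0 \<and> (\<forall>n j. 0 < j \<longrightarrow> j < n \<longrightarrow> 1 / 10 \<le> real j / real (n - j)
    \<longrightarrow> real j / real (n - j) \<le> 1 \<longrightarrow> q\<^sup>2 \<le> n \<longrightarrow>
    real (card {A. A \<subseteq> {1..n} \<and> card A = j \<and>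
        (\<exists>B C. B \<subseteq> {0..n} \<and> 2 \<le> card B \<and> card B \<le> q \<and> insert 0 A = B + C)})
      \<le> 3 * (real n + 1) ^ (q + 1) * exp (d - c * real n) * real (n choose j))"
proof -
  define p :: real where "p = 1 / (10 * 2 ^ (q\<^sup>2))"
  have p: "0 < p" "p \<le> 1" "p * 2 ^ (q ^ 2) \<le> 1 / 10"
  proof -
    have "(1::real) \<le> 2 ^ (q\<^sup>2)"
      by (rule one_le_power) simp
    then have "(1::real) \<le> 10 * 2 ^ (q\<^sup>2)"
      by linarith
    then show "p \<le> 1"
      by (simp add: p_def)
  qed (auto simp: p_def)
  define c where "c = p / real (q ^ 4)"
  define d where "d = p * real (q\<^sup>2) / real (q ^ 4) + p"
  have "real (card {A. A \<subseteq> {1..n} \<and> card A = j \<and>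
        (\<exists>B C. B \<subseteq> {0..n} \<and> 2 \<le> card B \<and> card B \<le> q \<and> insert 0 A = B + C)})
      \<le> 3 * (real n + 1) ^ (q + 1) * exp (d - c * real n) * real (n choose j)"
    if j: "0 < j" "j < n" "1 / 10 \<le> real j / real (n - j)" "real j / real (n - j) \<le> 1"
      and n: "q\<^sup>2 \<le> n" for n j
  proof -
    \<comment> \<open>The largest number of disjoint windows that the bound for a fixed summand
      permits.\<close>
    define M where "M = (n - q\<^sup>2) div q ^ 4"
    define E where "E B = {A. A \<subseteq> {1..n} \<and> card A = j \<and> (\<exists>C. insert 0 A = B + C)}" for B
    define P where "P = {B. B \<subseteq> {0..n} \<and> 2 \<le> card B \<and> card B \<le> q}"
    have finP: "finite P"
      by (rule finite_subset[of _ "Pow {0..n}"]) (auto simp: P_def)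
    have "q ^ 4 * M \<le> n - q\<^sup>2"
      by (simp add: M_def)
    then have M: "q ^ 4 * M + q\<^sup>2 \<le> n"
      using n by simp
    have "card P \<le> card {B. B \<subseteq> {0..n} \<and> card B \<le> q}"
      unfolding P_def by (intro card_mono) auto
    then have cardP: "real (card P) \<le> 3 * (real n + 1) ^ q"
      using card_subsets_le_polynomial[of "{0..n}" q] by (simp add: add.commute)
    have "(n - q\<^sup>2) < q ^ 4 * (M + 1)"
      unfolding M_def using assms
      by (metis add.commute mult.commute dividend_less_div_times mult_Suc_right plus_1_eq_Suc zero_less_power)
    then have "real (n - q\<^sup>2) \<le> real (q ^ 4) * (real M + 1)"
      by (metis less_imp_le of_nat_1 of_nat_add of_nat_le_iff of_nat_mult)
    then have "(real n - real (q\<^sup>2)) / real (q ^ 4) \<le> real M + 1"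
      using n assms by (simp add: of_nat_diff divide_le_eq mult.commute)
    then have "p * ((real n - real (q\<^sup>2)) / real (q ^ 4)) \<le> p * (real M + 1)"
      using p by (intro mult_left_mono) auto
    then have "- p * real M \<le> d - c * real n"
      by (simp add: d_def c_def algebra_simps diff_divide_distrib)
    moreover have "(1 - p) ^ M \<le> exp (- p) ^ M"
      using p exp_ge_add_one_self[of "- p"] by (intro power_mono) auto
    moreover have "exp (- p) ^ M = exp (- p * real M)"
      by (simp flip: exp_of_nat2_mult)
    ultimately have pM: "(1 - p) ^ M \<le> exp (d - c * real n)"
      by (smt (verit) exp_le_cancel_iff)
    have "{A. A \<subseteq> {1..n} \<and> card A = j \<and>
        (\<exists>B C. B \<subseteq> {0..n} \<and> 2 \<le> card B \<and> card B \<le> q \<and> insert 0 A = B + C)} = (\<Union>B\<in>P. E B)"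
      by (auto simp: P_def E_def)
    then have "real (card {A. A \<subseteq> {1..n} \<and> card A = j \<and>
        (\<exists>B C. B \<subseteq> {0..n} \<and> 2 \<le> card B \<and> card B \<le> q \<and> insert 0 A = B + C)})
      \<le> real (\<Sum>B\<in>P. card (E B))"
      using finP by (simp only: of_nat_le_iff card_UN_le)
    also have "\<dots> \<le> (\<Sum>B\<in>P. (real n + 1) * real (n choose j) * (1 - p) ^ M)"
      unfolding of_nat_sum E_def using p j M
      by (intro sum_mono card_sumsets_fixed_summand[where q = q]) (auto simp: P_def)
    also have "\<dots> = real (card P) * ((real n + 1) * real (n choose j) * (1 - p) ^ M)"
      by simp
    also have "\<dots> \<le> (3 * (real n + 1) ^ q) * ((real n + 1) * real (n choose j) * exp (d - c * real n))"
      using cardP pM p by (intro mult_mono) auto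
    finally show ?thesis
      by (simp add: mult_ac)
  qed
  moreover have "c > 0"
    using p assms by (simp add: c_def)
  ultimately show ?thesis
    by blast
qed

section \<open>Sumsets with one large summand\<close>

text \<open>A large \<open>C\<close> contains linearly many \<open>x\<close> for which the translates \<open>x + B'\<close> of a fixed 32-subset
  \<open>B'\<close> of \<open>B\<close> are disjoint; since a set of density below 1/2 contains all of them with probability
  about \<open>2 ^ (-32 |X|)\<close>, this beats the number of choices of \<open>X\<close>.\<close>

lemma card_sumsets_large_summand:
  fixes n j :: nat
  assumes j: "0 < j" "j < n" "real j / real (n - j) \<le> 1"
  shows "real (card {A. A \<subseteq> {1..n} \<and> card A = j \<and>
        (\<exists>B C. 32 \<le> card B \<and> n div 500 < card (C - {0}) \<and> 0 \<in> B \<and> 0 \<in> C \<and> insert 0 A = B + C)})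
      \<le> 3 * (real n + 1) ^ 33 * exp (1 - real n / 1000000) * real (n choose j)"
proof -
  \<comment> \<open>Here \<open>512000 = 500 * 32\<^sup>2\<close>: more than
    \<open>n div 500\<close> candidates \<open>x\<close> are available, and each selected one rules
    out at most \<open>32\<^sup>2\<close> of them.\<close>
  define M where "M = n div 512000"
  define PB where "PB = {B. B \<subseteq> {0..n} \<and> card B \<le> 32}"
  define PX where "PX = {X. X \<subseteq> {1..n} \<and> card X \<le> M}"
  define P where "P = {(B, X). B \<in> PB \<and> X \<in> PX \<and> X + B \<subseteq> {1..n} \<and> card (X + B) = 32 * M}"
  define E where "E = (\<lambda>(B, X). {A. A \<subseteq> {1..n} \<and> card A = j \<and> X + B \<subseteq> A})"
  have finPB: "finite PB"
    by (rule finite_subset[of _ "Pow {0..n}"]) (auto simp: PB_def)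
  have finPX: "finite PX"
    by (rule finite_subset[of _ "Pow {1..n}"]) (auto simp: PX_def)
  have PPP: "P \<subseteq> PB \<times> PX"
    by (auto simp: P_def)
  have finP: "finite P"
    using PPP finPB finPX by (simp add: finite_subset)
  have finE: "finite (E a)" for a
    by (rule finite_subset[of _ "Pow {1..n}"]) (auto simp: E_def split: prod.splits)
  have "card P \<le> card PB * card PX"
    using PPP finPB finPX card_mono[of "PB \<times> PX" P] by (simp add: card_cartesian_product)
  then have "real (card P) \<le> real (card PB * card PX)"
    by (rule of_nat_mono)
  moreover have "real (card PB) \<le> 3 * (real n + 1) ^ 32"
    unfolding PB_def using card_subsets_le_polynomial[of "{0..n}" 32] by (simp add: add.commute)
  ultimately have cardP: "real (card P) \<le> 3 * (real n + 1) ^ 32 * real (card PX)"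
    by (smt (verit) mult_right_mono of_nat_0_le_iff of_nat_mult)
  \<comment> \<open>The factor \<open>2 ^ (-32 * M)\<close> is split: \<open>2 ^ (-24 * M)\<close>
    pays for the choice of \<open>X\<close> up to \<open>exp (n / 2 ^ 24)\<close>, and
    \<open>2 ^ (-8 * M)\<close> is left as the gain, at most \<open>exp (- M)\<close>.\<close>
  have "real (card PX) * (1 / 2 ^ 24) ^ M \<le> (1 + 1 / 2 ^ 24) ^ n"
    unfolding PX_def using card_subsets_le_mult_power[of "{1..n}" "1 / 2 ^ 24" M] by simp
  also have "\<dots> \<le> exp (1 / 2 ^ 24) ^ n"
    by (intro power_mono exp_ge_add_one_self) auto
  also have "\<dots> = exp (real n / 2 ^ 24)"
    by (simp flip: exp_of_nat_mult)
  finally have "real (card PX) * (1 / 2 ^ 24) ^ M * (1 / 2 ^ 8) ^ M \<le> exp (real n / 2 ^ 24) * (1 / 2 ^ 8) ^ M"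
    by (intro mult_right_mono) auto
  moreover have "(1 / 2 ^ 24) ^ M * (1 / 2 ^ 8) ^ M = (1 / 2 :: real) ^ (32 * M)"
    by (simp add: power_mult power_divide flip: power_mult_distrib)
  moreover have "(1 / 2 ^ 8 :: real) ^ M \<le> exp (- 1) ^ M"
    using exp_le by (intro power_mono) (auto simp: exp_minus field_simps)
  moreover have "exp (- 1 :: real) ^ M = exp (- real M)"
    by (simp flip: exp_of_nat_mult)
  ultimately have "real (card PX) * (1 / 2) ^ (32 * M) \<le> exp (real n / 2 ^ 24) * exp (- real M)"
    by (smt (verit) exp_gt_zero mult.assoc mult_left_mono)
  also have "\<dots> = exp (real n / 2 ^ 24 - real M)"
    by (simp flip: exp_add)
  also have "\<dots> \<le> exp (1 - real n / 1000000)"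
  proof -
    \<comment> \<open>The rate 1/1000000 is below \<open>1 / 512000 - 1 / 2 ^ 24\<close>, and the 1
      in the exponent pays for rounding in \<open>M\<close>.\<close>
    have "n < 512000 * (M + 1)"
      unfolding M_def by simp
    then have "real n < real (512000 * (M + 1))"
      by (simp only: of_nat_less_iff)
    then have "real n \<le> 512000 * (real M + 1)"
      by simp
    then show ?thesis
      by simp
  qed
  finally have PX: "real (card PX) * (1 / 2) ^ (32 * M) \<le> exp (1 - real n / 1000000)" .
  have "{A. A \<subseteq> {1..n} \<and> card A = j \<and>
        (\<exists>B C. 32 \<le> card B \<and> n div 500 < card (C - {0}) \<and> 0 \<in> B \<and> 0 \<in> C \<and> insert 0 A = B + C)}
      \<subseteq> (\<Union>a\<in>P. E a)"
  proof
    fix A assume "A \<in> {A. A \<subseteq> {1..n} \<and> card A = j \<and>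
        (\<exists>B C. 32 \<le> card B \<and> n div 500 < card (C - {0}) \<and> 0 \<in> B \<and> 0 \<in> C \<and> insert 0 A = B + C)}"
    then obtain B C where A: "A \<subseteq> {1..n}" "card A = j"
      and BC: "32 \<le> card B" "n div 500 < card (C - {0})" "0 \<in> B" "0 \<in> C" "insert 0 A = B + C"
      by blast
    have An: "insert 0 A \<subseteq> {0..n}"
      using A by auto
    have sub: "B \<subseteq> insert 0 A" "C \<subseteq> insert 0 A"
      using BC set_plus_intro[of _ B 0 C] set_plus_intro[of 0 B _ C] by auto
    obtain B' where B': "B' \<subseteq> B" "card B' = 32" "finite B'"
      using BC(1) obtain_subset_with_card_n by metis
    \<comment> \<open>With positive \<open>x\<close>, the whole translate \<open>x + B'\<close>
      avoids 0 and therefore lies in \<open>A\<close>.\<close>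
    define S where "S = C - {0}"
    have S: "S \<subseteq> {1..n}"
      using sub A by (auto simp: S_def)
    then have "finite S"
      by (rule finite_subset) simp
    define V where "V x = (\<lambda>b. x + b) ` B'" for x
    have cardV: "card (V x) = 32" for x
      unfolding V_def using B' by (simp add: card_image)
    have "\<exists>X\<subseteq>S. disjoint_family_on V X \<and> card S \<le> 1024 * card X"
    proof (rule greedy_disjoint_subfamily)
      fix x assume "x \<in> S"
      show "V x \<noteq> {}"
        using cardV[of x] by auto
      \<comment> \<open>A collision \<open>x + b = y + b'\<close> determines \<open>y\<close> from
        \<open>b\<close> and \<open>b'\<close>, so there are at most
        \<open>32\<^sup>2 = 1024\<close> of them.\<close>
      have "{y\<in>S. V x \<inter> V y \<noteq> {}} \<subseteq> (\<lambda>(b, b'). x + b - b') ` (B' \<times> B')"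
        by (force simp: V_def)
      then have "card {y\<in>S. V x \<inter> V y \<noteq> {}} \<le> card (B' \<times> B')"
        using B'(3) by (intro surj_card_le) auto
      then show "card {y\<in>S. V x \<inter> V y \<noteq> {}} \<le> 1024"
        by (simp add: card_cartesian_product B')
    qed (use \<open>finite S\<close> in auto)
    then obtain X0 where X0: "X0 \<subseteq> S" "disjoint_family_on V X0" "card S \<le> 1024 * card X0"
      by blast
    have "M \<le> card X0"
      using X0(3) BC(2) unfolding M_def S_def by linarith
    then obtain X where X: "X \<subseteq> X0" "card X = M" "finite X"
      using obtain_subset_with_card_n by metis
    have XB: "X + B' = (\<Union>x\<in>X. V x)"
      by (auto simp: V_def set_plus_def)
    have "disjoint_family_on V X"
      using X(1) X0(2) by (rule disjoint_family_on_mono)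
    then have "card (X + B') = (\<Sum>x\<in>X. card (V x))"
      unfolding XB using X(3) B'(3)
      by (intro card_UN_disjoint) (simp_all add: V_def disjoint_family_on_def)
    then have "card (X + B') = 32 * M"
      using X by (simp add: cardV)
    moreover have "X + B' \<subseteq> A"
    proof
      fix y assume "y \<in> X + B'"
      then obtain x b where xb: "x \<in> X" "b \<in> B'" "y = x + b"
        by (auto elim: set_plus_elim)
      then have "x \<in> C" "x \<noteq> 0" "b \<in> B"
        using X X0 B' by (auto simp: S_def)
      then have "b + x \<in> insert 0 A"
        unfolding BC(5) by (intro set_plus_intro)
      then show "y \<in> A"
        using xb \<open>x \<noteq> 0\<close> by (auto simp: add.commute)
    qed
    moreover have "B' \<in> PB"
      using B' sub An by (auto simp: PB_def)
    moreover have "X \<in> PX"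
      using X X0 S by (auto simp: PX_def)
    ultimately show "A \<in> (\<Union>a\<in>P. E a)"
      using A by (auto simp: P_def E_def intro!: bexI[of _ "(B', X)"])
  qed
  then have "real (card {A. A \<subseteq> {1..n} \<and> card A = j \<and>
        (\<exists>B C. 32 \<le> card B \<and> n div 500 < card (C - {0}) \<and> 0 \<in> B \<and> 0 \<in> C \<and> insert 0 A = B + C)})
      \<le> real (card (\<Union>a\<in>P. E a))"
    using finP finE by (intro of_nat_mono card_mono) auto
  also have "\<dots> \<le> real (\<Sum>a\<in>P. card (E a))"
    using finP by (intro of_nat_mono card_UN_le)
  also have "\<dots> \<le> (\<Sum>a\<in>P. (real n + 1) * real (n choose j) * (1 / 2) ^ (32 * M))"
    unfolding of_nat_sum
  proof (rule sum_mono)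
    fix a assume "a \<in> P"
    then obtain B X where "a = (B, X)" "X + B \<subseteq> {1..n}" "card (X + B) = 32 * M"
      by (auto simp: P_def)
    then show "real (card (E a)) \<le> (real n + 1) * real (n choose j) * (1 / 2) ^ (32 * M)"
      using card_subsets_containing_le[OF j, of "X + B"] by (simp add: E_def)
  qed
  also have "\<dots> = real (card P) * ((real n + 1) * real (n choose j) * (1 / 2) ^ (32 * M))"
    by simp
  also have "\<dots> \<le> (3 * (real n + 1) ^ 32 * real (card PX)) * ((real n + 1) * real (n choose j) * (1 / 2) ^ (32 * M))"
    by (intro mult_right_mono cardP) auto
  also have "\<dots> = 3 * (real n + 1) ^ 33 * (real (card PX) * (1 / 2) ^ (32 * M)) * real (n choose j)"
  proof -
    have "(real n + 1) ^ 33 = (real n + 1) ^ 32 * (real n + 1)"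
      by (metis power_Suc2 eval_nat_numeral(3))
    then show ?thesis
      by (simp only: mult_ac)
  qed
  also have "\<dots> \<le> 3 * (real n + 1) ^ 33 * exp (1 - real n / 1000000) * real (n choose j)"
    by (intro mult_right_mono mult_left_mono PX) auto
  finally show ?thesis .
qed

section \<open>Sumsets of two small summands\<close>

text \<open>\<open>A\<close> is determined by the nonzero parts of \<open>B\<close> and
  \<open>C\<close>, and there are at most \<open>(101 / 100) ^ (4 * n)\<close> such pairs. Odds of
  at least 1/10 force \<open>(n + 1) * (n choose j)\<close> to be at least
  \<open>(11 / 10) ^ n\<close>, which is exponentially larger.\<close>

lemma card_sumsets_small_summands:
  fixes n j :: nat
  assumes j: "0 < j" "j < n" "1 / 10 \<le> real j / real (n - j)" "real j / real (n - j) \<le> 1"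
  shows "real (card {A. A \<subseteq> {1..n} \<and> card A = j \<and>
        (\<exists>B C. card (B - {0}) \<le> n div 500 \<and> card (C - {0}) \<le> n div 500 \<and> 0 \<in> B \<and> 0 \<in> C \<and>
          insert 0 A = B + C)})
      \<le> (real n + 1) * exp (- real n / 22) * real (n choose j)"
proof -
  define m where "m = n div 500"
  define z where "z = real j / real (n - j)"
  define P where "P = {B. B \<subseteq> {1..n} \<and> card B \<le> m}"
  have finP: "finite P"
    by (rule finite_subset[of _ "Pow {1..n}"]) (auto simp: P_def)
  have "{A. A \<subseteq> {1..n} \<and> card A = j \<and>
        (\<exists>B C. card (B - {0}) \<le> m \<and> card (C - {0}) \<le> m \<and> 0 \<in> B \<and> 0 \<in> C \<and> insert 0 A = B + C)}
      \<subseteq> (\<lambda>(B, C). (insert 0 B + insert 0 C) - {0}) ` (P \<times> P)"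
  proof
    fix A assume "A \<in> {A. A \<subseteq> {1..n} \<and> card A = j \<and>
        (\<exists>B C. card (B - {0}) \<le> m \<and> card (C - {0}) \<le> m \<and> 0 \<in> B \<and> 0 \<in> C \<and> insert 0 A = B + C)}"
    then obtain B C where A: "A \<subseteq> {1..n}" "card A = j"
      and BC: "card (B - {0}) \<le> m" "card (C - {0}) \<le> m" "0 \<in> B" "0 \<in> C" "insert 0 A = B + C"
      by blast
    have "B \<subseteq> insert 0 A" "C \<subseteq> insert 0 A"
      using BC set_plus_intro[of _ B 0 C] set_plus_intro[of 0 B _ C] by auto
    then have "B - {0} \<in> P" "C - {0} \<in> P"
      using A BC by (auto simp: P_def)
    moreover have "insert 0 (B - {0}) = B" "insert 0 (C - {0}) = C"
      using BC by auto
    moreover have "A = B + C - {0}"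
      using A BC(5) by force
    ultimately show "A \<in> (\<lambda>(B, C). (insert 0 B + insert 0 C) - {0}) ` (P \<times> P)"
      by (auto intro!: image_eqI[of _ _ "(B - {0}, C - {0})"])
  qed
  then have "card {A. A \<subseteq> {1..n} \<and> card A = j \<and>
        (\<exists>B C. card (B - {0}) \<le> m \<and> card (C - {0}) \<le> m \<and> 0 \<in> B \<and> 0 \<in> C \<and> insert 0 A = B + C)}
      \<le> card (P \<times> P)"
    using finP by (intro surj_card_le) auto
  then have "real (card {A. A \<subseteq> {1..n} \<and> card A = j \<and>
        (\<exists>B C. card (B - {0}) \<le> m \<and> card (C - {0}) \<le> m \<and> 0 \<in> B \<and> 0 \<in> C \<and> insert 0 A = B + C)})
      \<le> real (card (P \<times> P))"
    by (rule of_nat_mono)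
  also have "real (card (P \<times> P)) = real (card P) ^ 2"
    by (simp add: card_cartesian_product power2_eq_square)
  finally have le: "real (card {A. A \<subseteq> {1..n} \<and> card A = j \<and>
        (\<exists>B C. card (B - {0}) \<le> m \<and> card (C - {0}) \<le> m \<and> 0 \<in> B \<and> 0 \<in> C \<and> insert 0 A = B + C)})
      \<le> real (card P) ^ 2" .
  have "real (card P) * (1 / 100) ^ m \<le> (1 + 1 / 100) ^ n"
    unfolding P_def using card_subsets_le_mult_power[of "{1..n}" "1 / 100" m] by simp
  then have "real (card P) \<le> (101 / 100) ^ n * 100 ^ m"
    by (simp add: power_divide field_simps)
  \<comment> \<open>The density 1/500 is small enough for \<open>100 ^ m\<close> to cost no more
    than another \<open>(101 / 100) ^ n\<close>.\<close>
  also have "(100::real) ^ m \<le> ((101 / 100) ^ 500) ^ m"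
  proof (rule power_mono)
    have "(100::real) \<le> (((11 / 10) ^ 5)) ^ 10"
      by (simp add: field_simps)
    also have "\<dots> \<le> (((101 / 100) ^ 10) ^ 5) ^ 10"
      by (intro power_mono) (simp_all add: field_simps)
    also have "\<dots> = (101 / 100) ^ 500"
      by (simp flip: power_mult)
    finally show "(100::real) \<le> (101 / 100) ^ 500" .
  qed simp
  also have "((101 / 100 :: real) ^ 500) ^ m = (101 / 100) ^ (500 * m)"
    by (simp only: power_mult)
  also have "\<dots> \<le> (101 / 100) ^ n"
    by (intro power_increasing) (auto simp: m_def)
  finally have "real (card P) \<le> (101 / 100) ^ n * (101 / 100) ^ n"
    by simp
  then have "real (card P) ^ 2 \<le> ((101 / 100) ^ n * (101 / 100) ^ n) ^ 2"
    by (intro power_mono) auto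
  also have "\<dots> = ((101 / 100) ^ 4) ^ n"
    by (simp add: power_mult[symmetric] mult.commute flip: power_add)
  also have "\<dots> \<le> (11 / 10 * exp (- 1 / 22)) ^ n"
  proof (rule power_mono)
    \<comment> \<open>The rate 1/22 makes the right-hand side \<open>21 / 20\<close>, still above
      \<open>(101 / 100) ^ 4\<close>.\<close>
    have "(101 / 100) ^ 4 \<le> 11 / 10 * (1 + (- 1 / 22) :: real)"
      by (simp add: field_simps)
    also have "\<dots> \<le> 11 / 10 * exp (- 1 / 22)"
      by (intro mult_left_mono exp_ge_add_one_self) auto
    finally show "(101 / 100) ^ 4 \<le> 11 / 10 * exp (- 1 / 22 :: real)" .
  qed auto
  also have "\<dots> = (11 / 10) ^ n * exp (- real n / 22)"
    unfolding power_mult_distrib by (simp flip: exp_of_nat_mult)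
  also have "\<dots> \<le> ((real n + 1) * real (n choose j)) * exp (- real n / 22)"
  proof (rule mult_right_mono)
    have z: "1 / 10 \<le> z" "z \<le> 1"
      using j by (auto simp: z_def)
    have "(11 / 10) ^ n \<le> (1 + z) ^ n"
      using z by (intro power_mono) auto
    also have "\<dots> \<le> (real n + 1) * real (n choose j) * z ^ j"
      unfolding z_def using j by (intro power_one_plus_le_mode)
    also have "\<dots> \<le> (real n + 1) * real (n choose j) * 1"
      using z by (intro mult_left_mono power_le_one) auto
    finally show "(11 / 10) ^ n \<le> (real n + 1) * real (n choose j)"
      by simp
  qed simp
  also have "\<dots> = (real n + 1) * exp (- real n / 22) * real (n choose j)"
    by simp
  finally show ?thesis
    using le unfolding m_def by (rule order_trans[rotated])
qed

section \<open>Union bound over the three kinds of decomposition\<close>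

theorem theorem4p6:
  shows "\<exists>(c::real) (n0::nat). c > 0 \<and>
    (\<forall>n\<ge>n0. \<forall>k::nat. 0.111 * real n < real k \<and> real k < 0.5 * real n \<longrightarrow>
      real (alpha n k) \<ge> real (n choose (k - 1)) * (1 - exp (- c * (real n / ln (real n)))))"
proof -
  obtain c d :: real where c: "c > 0" and bounded: "\<And>n j. 0 < j \<Longrightarrow> j < n \<Longrightarrow>
      1 / 10 \<le> real j / real (n - j) \<Longrightarrow> real j / real (n - j) \<le> 1 \<Longrightarrow> 31\<^sup>2 \<le> n \<Longrightarrow>
      real (card {A. A \<subseteq> {1..n} \<and> card A = j \<and>
        (\<exists>B C. B \<subseteq> {0..n} \<and> 2 \<le> card B \<and> card B \<le> 31 \<and> insert 0 A = B + C)})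
      \<le> 3 * (real n + 1) ^ (31 + 1) * exp (d - c * real n) * real (n choose j)"
    using card_sumsets_bounded_summand[of 31, OF zero_less_numeral] by blast
  \<comment> \<open>The smallest of the three exponential rates, as 1/22 is larger. Half of it is
    given up to absorb the polynomial factors.\<close>
  define c' where "c' = min c (1 / 1000000)"
  have c': "c' > 0"
    using c by (simp add: c'_def)
  have "eventually (\<lambda>n::nat. 3 * (real n + 1) ^ (31 + 1) * exp (d - c * real n)
      + 3 * (real n + 1) ^ 33 * exp (1 - real n / 1000000) + (real n + 1) * exp (- real n / 22)
      \<le> exp (- (c' / 2) * (real n / ln (real n)))) sequentially"
  proof -
    have 1: "eventually (\<lambda>n::nat. 3 * (real n + 1) ^ (31 + 1) * exp (d - c * real n)
        \<le> exp (- (c / 2) * real n) / 3) sequentially"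
      using c by real_asymp
    have 2: "eventually (\<lambda>n::nat. 3 * (real n + 1) ^ 33 * exp (1 - real n / 1000000)
        \<le> exp (- (1 / 2000000) * real n) / 3) sequentially"
      by real_asymp
    have 3: "eventually (\<lambda>n::nat. (real n + 1) * exp (- real n / 22)
        \<le> exp (- (1 / 2000000) * real n) / 3) sequentially"
      by real_asymp
    have 4: "eventually (\<lambda>n::nat. ln (real n) \<ge> 1) sequentially"
      by real_asymp
    show ?thesis
      using 1 2 3 4
    proof eventually_elim
      case (elim n)
      \<comment> \<open>The error obtained is exponential in \<open>n\<close>; it is weakened to the
        required form here.\<close>
      have "real n / ln (real n) \<le> real n"
        using elim(4) by (simp add: divide_le_eq mult_left_le_imp_le mult_le_cancel_left1)
      then have "c' / 2 * (real n / ln (real n)) \<le> c' / 2 * real n"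
        using c' by (intro mult_left_mono) auto
      moreover have "c' / 2 * real n \<le> c / 2 * real n" "c' / 2 * real n \<le> 1 / 2000000 * real n"
        by (intro mult_right_mono; simp add: c'_def)+
      ultimately have "exp (- (c / 2) * real n) \<le> exp (- (c' / 2) * (real n / ln (real n)))"
        "exp (- (1 / 2000000) * real n) \<le> exp (- (c' / 2) * (real n / ln (real n)))"
        by simp_all
      then show ?case
        using elim by linarith
    qed
  qed
  then obtain n1 where n1: "\<And>n. n \<ge> n1 \<Longrightarrow> 3 * (real n + 1) ^ (31 + 1) * exp (d - c * real n)
      + 3 * (real n + 1) ^ 33 * exp (1 - real n / 1000000) + (real n + 1) * exp (- real n / 22)
      \<le> exp (- (c' / 2) * (real n / ln (real n)))"
    by (auto simp: eventually_sequentially)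
  have "real (alpha n k) \<ge> real (n choose (k - 1)) * (1 - exp (- (c' / 2) * (real n / ln (real n))))"
    if n: "n \<ge> max n1 1000" and k: "0.111 * real n < real k" "real k < 0.5 * real n" for n k
  proof -
    \<comment> \<open>A set of size \<open>k\<close> containing 0 is encoded by its
      \<open>k - 1\<close> nonzero elements, hence the binomial coefficient.\<close>
    define j where "j = k - 1"
    have "real k > 1"
      using n k by simp
    then have kj: "k = j + 1" "0 < j"
      by (auto simp: j_def)
    \<comment> \<open>From \<open>n \<ge> 1000\<close> follow
      \<open>31\<^sup>2 = 961 \<le> n\<close> and \<open>0.111 * n - 1 \<ge> n / 10\<close>, which
      covers the shift from \<open>k\<close> to \<open>j\<close>. The bounds on \<open>j\<close>
      then keep the odds between 1/10 and 1.\<close>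
    have jn: "j < n" "real j \<le> real n / 2" "real n / 10 \<le> real j" "31\<^sup>2 \<le> n"
      using n k kj by auto
    have zj: "1 / 10 \<le> real j / real (n - j)" "real j / real (n - j) \<le> 1"
      using jn by (auto simp: of_nat_diff field_simps)
    define T where "T = {A. A \<subseteq> {1..n} \<and> card A = j}"
    define E1 where "E1 = {A. A \<subseteq> {1..n} \<and> card A = j \<and>
        (\<exists>B C. B \<subseteq> {0..n} \<and> 2 \<le> card B \<and> card B \<le> 31 \<and> insert 0 A = B + C)}"
    define E2 where "E2 = {A. A \<subseteq> {1..n} \<and> card A = j \<and>
        (\<exists>B C. 32 \<le> card B \<and> n div 500 < card (C - {0}) \<and> 0 \<in> B \<and> 0 \<in> C \<and> insert 0 A = B + C)}"
    define E3 where "E3 = {A. A \<subseteq> {1..n} \<and> card A = j \<and>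
        (\<exists>B C. card (B - {0}) \<le> n div 500 \<and> card (C - {0}) \<le> n div 500 \<and> 0 \<in> B \<and> 0 \<in> C \<and>
          insert 0 A = B + C)}"
    define G where "G = {A \<in> T. insert 0 A \<in> atoms}"
    have finT: "finite T"
      by (rule finite_subset[of _ "Pow {1..n}"]) (auto simp: T_def)
    have ET: "E1 \<subseteq> T" "E2 \<subseteq> T" "E3 \<subseteq> T"
      by (auto simp: T_def E1_def E2_def E3_def)
    then have finE: "finite E1" "finite E2" "finite E3"
      using finT by (auto intro: finite_subset)
    have cardT: "card T = n choose j"
      using n_subsets[of "{1..n}" j] by (simp add: T_def)
    have "T - G \<subseteq> E1 \<union> E2 \<union> E3"
    proof
      fix A assume "A \<in> T - G"
      then have A: "A \<subseteq> {1..n}" "card A = j" "insert 0 A \<notin> atoms"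
        by (auto simp: T_def G_def)
      have "A \<noteq> {}" "finite A"
        using A kj finite_subset[of A "{1..n}"] by auto
      then have "insert 0 A \<noteq> {0}"
        using A(1) by fastforce
      then obtain B C where BC: "B \<in> Pfin0" "C \<in> Pfin0" "insert 0 A = B + C" "B \<noteq> {0}" "C \<noteq> {0}"
        using A(3) \<open>finite A\<close> by (auto simp: atoms_def Pfin0_def)
      then have fin: "finite B" "finite C" "0 \<in> B" "0 \<in> C"
        by (auto simp: Pfin0_def)
      have sub: "B \<subseteq> insert 0 A" "C \<subseteq> insert 0 A"
        using BC fin set_plus_intro[of _ B 0 C] set_plus_intro[of 0 B _ C] by auto
      have "insert 0 A \<subseteq> {0..n}"
        using A(1) by auto
      with sub have sub: "B \<subseteq> {0..n}" "C \<subseteq> {0..n}"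
        by auto
      have two: "2 \<le> card D" if "finite D" "0 \<in> D" "D \<noteq> {0}" for D :: "nat set"
        using that by (metis card_le_Suc0_iff_eq not_less_eq_eq numeral_2_eq_2 singleton_iff subsetI
            subset_singleton_iff insert_absorb empty_not_insert)
      have CB: "insert 0 A = C + B"
        using BC(3) by (simp add: add.commute)
      \<comment> \<open>If both summands have at least 32 elements, either one of them has more than
        \<open>n div 500\<close> nonzero elements and plays the part of \<open>C\<close> in
        \<open>E2\<close>, after a swap if necessary, or neither does.\<close>
      consider "card B \<le> 31" | "card C \<le> 31" | "32 \<le> card B" "n div 500 < card (C - {0})"
        | "32 \<le> card C" "n div 500 < card (B - {0})"
        | "card (B - {0}) \<le> n div 500" "card (C - {0}) \<le> n div 500"
        by linarith
      then show "A \<in> E1 \<union> E2 \<union> E3"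
      proof cases
        case 1
        then have "A \<in> E1"
          using A BC fin sub two[of B] unfolding E1_def by blast
        then show ?thesis by simp
      next
        case 2
        then have "A \<in> E1"
          using A BC(5) CB fin sub two[of C] unfolding E1_def by blast
        then show ?thesis by simp
      next
        case 3
        then have "A \<in> E2"
          using A BC(3) fin unfolding E2_def by blast
        then show ?thesis by simp
      next
        case 4
        then have "A \<in> E2"
          using A CB fin unfolding E2_def by blast
        then show ?thesis by simp
      next
        case 5
        then have "A \<in> E3"
          using A BC(3) fin unfolding E3_def by blast
        then show ?thesis by simp
      qed
    qed
    then have "card (T - G) \<le> card (E1 \<union> E2 \<union> E3)"
      using finE by (intro card_mono) auto
    also have "\<dots> \<le> card E1 + card E2 + card E3"
      using card_Un_le[of "E1 \<union> E2" E3] card_Un_le[of E1 E2] by linarith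
    finally have "real (card (T - G)) \<le> real (card E1) + real (card E2) + real (card E3)"
      by linarith
    also have "\<dots> \<le> 3 * (real n + 1) ^ (31 + 1) * exp (d - c * real n) * real (n choose j)
      + 3 * (real n + 1) ^ 33 * exp (1 - real n / 1000000) * real (n choose j)
      + (real n + 1) * exp (- real n / 22) * real (n choose j)"
      unfolding E1_def E2_def E3_def using kj jn zj
      by (intro add_mono bounded card_sumsets_large_summand card_sumsets_small_summands)
    also have "\<dots> = (3 * (real n + 1) ^ (31 + 1) * exp (d - c * real n)
      + 3 * (real n + 1) ^ 33 * exp (1 - real n / 1000000) + (real n + 1) * exp (- real n / 22))
      * real (n choose j)"
      by (simp only: distrib_right)
    also have "\<dots> \<le> exp (- (c' / 2) * (real n / ln (real n))) * real (n choose j)"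
      using n by (intro mult_right_mono n1) auto
    finally have bad: "real (card (T - G)) \<le> exp (- (c' / 2) * (real n / ln (real n))) * real (n choose j)" .
    have "G \<subseteq> T"
      by (auto simp: G_def)
    then have TG: "card T = card G + card (T - G)"
      using finT by (metis card_Diff_subset card_mono finite_subset le_add_diff_inverse)
    \<comment> \<open>For a lower bound on \<open>alpha n k\<close> an injection suffices: adding 0
      turns a \<open>j\<close>-subset of \<open>{1..n}\<close> into a set of size \<open>k\<close>
      with maximum at most \<open>n\<close>.\<close>
    have "card G \<le> card (atoms_nk n k)"
    proof (rule card_inj_on_le[of "insert 0"])
      show "inj_on (insert 0) G"
      proof (rule inj_onI)
        fix A A' assume "A \<in> G" "A' \<in> G" and eq: "insert 0 A = insert 0 A'"
        then have "0 \<notin> A" "0 \<notin> A'"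
          by (auto simp: G_def T_def)
        then show "A = A'"
          using eq by (metis insert_ident)
      qed
      show "insert 0 ` G \<subseteq> atoms_nk n k"
      proof clarify
        fix A assume "A \<in> G"
        then have A: "A \<subseteq> {1..n}" "card A = j" "insert 0 A \<in> atoms"
          by (auto simp: G_def T_def)
        moreover have "finite A" "0 \<notin> A"
          using A finite_subset[of A "{1..n}"] by auto
        ultimately show "insert 0 A \<in> atoms_nk n k"
          using kj by (auto simp: atoms_nk_def intro!: Max.boundedI)
      qed
      show "finite (atoms_nk n k)"
      proof (rule finite_subset)
        show "atoms_nk n k \<subseteq> Pow {0..n}"
        proof clarify
          fix A x assume "A \<in> atoms_nk n k" "x \<in> A"
          then have "Max A \<le> n" "finite A"
            by (auto simp: atoms_nk_def atoms_def Pfin0_def)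
          then show "x \<in> {0..n}"
            using order_trans[OF Max_ge[OF _ \<open>x \<in> A\<close>]] by simp
        qed
      qed simp
    qed
    then have "real (n choose j) - real (card (T - G)) \<le> real (alpha n k)"
      using TG cardT by (simp add: alpha_def)
    moreover have "k - 1 = j"
      by (simp add: j_def)
    ultimately show ?thesis
      using bad by (simp only: right_diff_distrib mult.commute[of "real (n choose j)"] mult_1)
  qed
  then show ?thesis
    using c' by (intro exI[of _ "c' / 2"] exI[of _ "max n1 1000"]) auto
qed

end
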